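(* Let $X,Y$ be, conditionally on $\theta$, independent and distributed according to the Type I mixture model $$X\mid K\sim f_K \ \text{ with } K\mid\theta\sim g_\theta,\qquad Y\mid J\sim q_J\ \text{ with } J\mid\theta\sim h_\theta ,$$ and let $\theta$ have prior density $\pi$ on $\Theta$ with respect to a $\sigma$-finite measure $\tau$. Define $$m_\pi(k)=\int_\Theta g_\theta(k)\,\pi(\theta)\,d\tau(\theta),\quad k\in\mathcal K,$$ $$\pi_k(u)=\frac{\pi(u)\,g_u(k)}{m_\pi(k)},\qquad f'_x(k)=\frac{f_k(x)\,m_\pi(k)}{\int_{\mathcal K} f_{k}(x)\,m_\pi(k)\,d\mu(k)},\qquad u\in\Theta,\ x\in\mathbb R^d,\ k\in\mathcal K .$$ Then: (a) The posterior distribution of $\theta$ given $X=x$ is the distribution of a random element $U$ admitting the mixture representation $$U\mid K'\sim \pi_{K'},\qquad K'\sim f'_x ;$$ that is, $\pi(\theta\mid x)=\int_{\mathcal K}\pi_{k'}(\theta)\,f'_x(k')\,d\mu(k')$. (b) The Bayes predictive density of $Y$ given $X=x$ admits the mixture representation $$Y\mid J'\sim q_{J'},\qquad J'\sim h'_x ,$$ that is, $q_\pi(y\mid x)=\int_{\mathcal K} q_{j'}(y)\,h'_x(j')\,d\mu(j')$, where $$h'_x(j')=\int_{\mathcal K} q_\pi(j'\mid k')\,f'_x(k')\,d\mu(k'),\qquad q_\pi(j'\mid k')=\int_\Theta h_\theta(j')\,\pi_{k'}(\theta)\,d\tau(\theta).$$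
   Context: Setting: $X,Y$ take values in $\mathbb R^d$; the parameter $\theta$ lies in $\Theta\subseteq\mathbb R^p$; the mixing variables $K,J$ take values in a measurable space $\mathcal K$. For each $k,j\in\mathcal K$, $f_k$ and $q_j$ are known probability densities on $\mathbb R^d$ with respect to a $\sigma$-finite measure $\nu$; for each $\theta\in\Theta$, $g_\theta$ and $h_\theta$ are known probability densities on $\mathcal K$ with respect to a $\sigma$-finite measure $\mu$ (all jointly measurable in their arguments and indices). The notation $Z\sim f$ means that $Z$ has density $f$. Thus the density of $X$ given $\theta$ is $\int_{\mathcal K}f_k(x)g_\theta(k)\,d\mu(k)$, and the density of $Y$ given $\theta$ is $q(y\mid\theta)=\int_{\mathcal K}q_j(y)h_\theta(j)\,d\mu(j)$. The posterior density $\pi(\theta\mid x)$ is the density with respect to $\tau$ proportional, in $\theta$, to $\pi(\theta)\int_{\mathcal K}f_k(x)g_\theta(k)\,d\mu(k)$. The Bayes predictive density of $Y$ is the conditional density of $Y$ given $X=x$, i.e. $q_\pi(y\mid x)=\int_\Theta q(y\mid\theta)\,\pi(\theta\mid x)\,d\tau(\theta)$. Conventions: densities are identified when equal almost everywhere with respect to the dominating measure; $x$ is such that the normalizing constant $\int_{\mathcal K}f_k(x)m_\pi(k)\,d\mu(k)$ (the marginal density of $X$ at $x$) is positive and finite; $\pi_k$ is defined by the formula for $k$ with $0<m_\pi(k)<\infty$ and is an arbitrary (measurable in $k$) density otherwise. *)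

theory Defs
  imports "HOL-Probability.Probability"
begin

text \<open>
  All densities take values in \<^typ>\<open>ennreal\<close>, so every integral below is a Lebesgue integral that
  exists unconditionally, with the library conventions \<open>0 * \<infinity> = 0\<close>, \<open>a / \<infinity> = 0\<close> for finite \<open>a\<close>, and
  \<open>0 / 0 = 0\<close>.
\<close>

definition prob_density :: "'a measure \<Rightarrow> ('a \<Rightarrow> ennreal) \<Rightarrow> bool" where
  "prob_density N p \<longleftrightarrow> p \<in> borel_measurable N \<and> (\<integral>\<^sup>+ z. p z \<partial>N) = 1"

text \<open>The density of \<open>Z\<close> when \<open>Z | L \<sim> p\<^sub>L\<close> and \<open>L\<close> has density \<open>r\<close> with respect to \<open>\<mu>\<close>.\<close>

definition mixture_density ::
    "'k measure \<Rightarrow> ('k \<Rightarrow> ennreal) \<Rightarrow> ('k \<Rightarrow> 'a \<Rightarrow> ennreal) \<Rightarrow> 'a \<Rightarrow> ennreal" where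
  "mixture_density \<mu> r p z = (\<integral>\<^sup>+ k. p k z * r k \<partial>\<mu>)"

text \<open>
  On the probability space \<open>\<Omega>\<close>: \<open>Z | L \<sim> p\<^sub>L\<close> and \<open>L \<sim> r\<close>, where the \<open>p\<^sub>l\<close> are densities with respect
  to \<open>N\<close> and \<open>r\<close> is a density with respect to \<open>\<mu>\<close>; the first relation is expressed through the joint
  density of \<open>(L, Z)\<close>.
\<close>

definition mixture_representation ::
    "'w measure \<Rightarrow> 'k measure \<Rightarrow> ('w \<Rightarrow> 'k) \<Rightarrow> ('k \<Rightarrow> ennreal) \<Rightarrow>
     'a measure \<Rightarrow> ('w \<Rightarrow> 'a) \<Rightarrow> ('k \<Rightarrow> 'a \<Rightarrow> ennreal) \<Rightarrow> bool" where
  "mixture_representation \<Omega> \<mu> L r N Z p \<longleftrightarrow>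
     prob_space \<Omega> \<and>
     prob_density \<mu> r \<and> (\<forall>l\<in>space \<mu>. prob_density N (p l)) \<and>
     distributed \<Omega> \<mu> L r \<and>
     distributed \<Omega> (\<mu> \<Otimes>\<^sub>M N) (\<lambda>\<omega>. (L \<omega>, Z \<omega>)) (\<lambda>(l, z). r l * p l z)"

text \<open>
  \<open>p x\<close> is a version, for \<open>x \<in> G\<close>, of the conditional density of \<open>Z\<close> given \<open>X = x\<close>.  The space \<open>M\<close> need
  not be a probability space: under an improper prior the joint law of parameter and observations
  is an infinite measure, and conditioning is meaningful only on a set \<open>G\<close> where the marginal
  density of \<open>X\<close> is finite.
\<close>

definition conditional_density_on ::
    "'x set \<Rightarrow> 'w measure \<Rightarrow> 'x measure \<Rightarrow> ('w \<Rightarrow> 'x) \<Rightarrow>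
     'z measure \<Rightarrow> ('w \<Rightarrow> 'z) \<Rightarrow> ('x \<Rightarrow> 'z \<Rightarrow> ennreal) \<Rightarrow> bool" where
  "conditional_density_on G M L X N Z p \<longleftrightarrow>
     (\<lambda>(x, z). p x z) \<in> borel_measurable (L \<Otimes>\<^sub>M N) \<and>
     (\<forall>x\<in>G. prob_density N (p x)) \<and>
     (\<forall>A\<in>sets N. \<forall>B\<in>sets L. B \<subseteq> G \<longrightarrow>
        emeasure M {\<omega> \<in> space M. X \<omega> \<in> B \<and> Z \<omega> \<in> A} =
        (\<integral>\<^sup>+ \<omega>. (\<integral>\<^sup>+ z\<in>A. p (X \<omega>) z \<partial>N) * indicator B (X \<omega>) \<partial>M))"

text \<open>
  In what follows \<open>prior\<close> is the prior density with respect to \<open>\<tau>\<close>; \<open>g \<theta>\<close> and \<open>h \<theta>\<close> are the densities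
  of the mixing variables with respect to \<open>\<mu>\<close>; \<open>f k\<close> and \<open>q j\<close> are the component densities.
\<close>

definition m_prior ::
    "'t measure \<Rightarrow> ('t \<Rightarrow> ennreal) \<Rightarrow> ('t \<Rightarrow> 'k \<Rightarrow> ennreal) \<Rightarrow> 'k \<Rightarrow> ennreal" where
  "m_prior \<tau> prior g k = (\<integral>\<^sup>+ \<theta>. g \<theta> k * prior \<theta> \<partial>\<tau>)"

text \<open>
  The family \<open>\<pi>\<^sub>k\<close>; the densities \<open>\<rho> k\<close> are an arbitrary choice for those \<open>k\<close> at which the
  defining quotient is not available.
\<close>

definition pi_comp ::
    "'t measure \<Rightarrow> ('t \<Rightarrow> ennreal) \<Rightarrow> ('t \<Rightarrow> 'k \<Rightarrow> ennreal) \<Rightarrow> ('k \<Rightarrow> 't \<Rightarrow> ennreal) \<Rightarrow>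
     'k \<Rightarrow> 't \<Rightarrow> ennreal" where
  "pi_comp \<tau> prior g \<rho> k u =
     (if 0 < m_prior \<tau> prior g k \<and> m_prior \<tau> prior g k < \<infinity>
      then prior u * g u k / m_prior \<tau> prior g k
      else \<rho> k u)"

definition norm_const ::
    "'k measure \<Rightarrow> 't measure \<Rightarrow> ('t \<Rightarrow> ennreal) \<Rightarrow> ('t \<Rightarrow> 'k \<Rightarrow> ennreal) \<Rightarrow>
     ('k \<Rightarrow> 'x \<Rightarrow> ennreal) \<Rightarrow> 'x \<Rightarrow> ennreal" where
  "norm_const \<mu> \<tau> prior g f x = (\<integral>\<^sup>+ k. f k x * m_prior \<tau> prior g k \<partial>\<mu>)"

definition regular_points ::
    "'k measure \<Rightarrow> 't measure \<Rightarrow> ('t \<Rightarrow> ennreal) \<Rightarrow> ('t \<Rightarrow> 'k \<Rightarrow> ennreal) \<Rightarrow>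
     ('k \<Rightarrow> 'x \<Rightarrow> ennreal) \<Rightarrow> 'x set" where
  "regular_points \<mu> \<tau> prior g f =
     {x. 0 < norm_const \<mu> \<tau> prior g f x \<and> norm_const \<mu> \<tau> prior g f x < \<infinity>}"

definition f_prime ::
    "'k measure \<Rightarrow> 't measure \<Rightarrow> ('t \<Rightarrow> ennreal) \<Rightarrow> ('t \<Rightarrow> 'k \<Rightarrow> ennreal) \<Rightarrow>
     ('k \<Rightarrow> 'x \<Rightarrow> ennreal) \<Rightarrow> 'x \<Rightarrow> 'k \<Rightarrow> ennreal" where
  "f_prime \<mu> \<tau> prior g f x k = f k x * m_prior \<tau> prior g k / norm_const \<mu> \<tau> prior g f x"

text \<open>Prior times likelihood, normalised over the parameter space.\<close>

definition posterior_density ::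
    "'k measure \<Rightarrow> 't measure \<Rightarrow> ('t \<Rightarrow> ennreal) \<Rightarrow> ('t \<Rightarrow> 'k \<Rightarrow> ennreal) \<Rightarrow>
     ('k \<Rightarrow> 'x \<Rightarrow> ennreal) \<Rightarrow> 'x \<Rightarrow> 't \<Rightarrow> ennreal" where
  "posterior_density \<mu> \<tau> prior g f x \<theta> =
     prior \<theta> * mixture_density \<mu> (g \<theta>) f x / (\<integral>\<^sup>+ t. prior t * mixture_density \<mu> (g t) f x \<partial>\<tau>)"

definition predictive_density ::
    "'k measure \<Rightarrow> 't measure \<Rightarrow> ('t \<Rightarrow> ennreal) \<Rightarrow> ('t \<Rightarrow> 'k \<Rightarrow> ennreal) \<Rightarrow>
     ('t \<Rightarrow> 'k \<Rightarrow> ennreal) \<Rightarrow> ('k \<Rightarrow> 'x \<Rightarrow> ennreal) \<Rightarrow> ('k \<Rightarrow> 'y \<Rightarrow> ennreal) \<Rightarrow>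
     'x \<Rightarrow> 'y \<Rightarrow> ennreal" where
  "predictive_density \<mu> \<tau> prior g h f q x y =
     (\<integral>\<^sup>+ \<theta>. mixture_density \<mu> (h \<theta>) q y * posterior_density \<mu> \<tau> prior g f x \<theta> \<partial>\<tau>)"

text \<open>\<open>q\<^sub>\<pi>(j' | k')\<close>: not to be confused with the predictive density of the observable.\<close>

definition mixing_predictive ::
    "'t measure \<Rightarrow> ('t \<Rightarrow> ennreal) \<Rightarrow> ('t \<Rightarrow> 'k \<Rightarrow> ennreal) \<Rightarrow> ('t \<Rightarrow> 'k \<Rightarrow> ennreal) \<Rightarrow>
     ('k \<Rightarrow> 't \<Rightarrow> ennreal) \<Rightarrow> 'k \<Rightarrow> 'k \<Rightarrow> ennreal" where
  "mixing_predictive \<tau> prior g h \<rho> k' j' = (\<integral>\<^sup>+ \<theta>. h \<theta> j' * pi_comp \<tau> prior g \<rho> k' \<theta> \<partial>\<tau>)"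

definition h_prime ::
    "'k measure \<Rightarrow> 't measure \<Rightarrow> ('t \<Rightarrow> ennreal) \<Rightarrow> ('t \<Rightarrow> 'k \<Rightarrow> ennreal) \<Rightarrow>
     ('t \<Rightarrow> 'k \<Rightarrow> ennreal) \<Rightarrow> ('k \<Rightarrow> 't \<Rightarrow> ennreal) \<Rightarrow> ('k \<Rightarrow> 'x \<Rightarrow> ennreal) \<Rightarrow>
     'x \<Rightarrow> 'k \<Rightarrow> ennreal" where
  "h_prime \<mu> \<tau> prior g h \<rho> f x j' =
     (\<integral>\<^sup>+ k'. mixing_predictive \<tau> prior g h \<rho> k' j' * f_prime \<mu> \<tau> prior g f x k' \<partial>\<mu>)"

end

theory Submission
  imports Defs
begin

text \<open>
  Both mixture representations come from Bayes' rule at the level of the mixing variable. For fixed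
  regular \<open>x\<close> the weight \<open>f\<^sub>k(x) g\<^sub>\<theta>(k) \<pi>(\<theta>)\<close>, divided by the normalising constant, is a joint density
  of \<open>(k, \<theta>)\<close>. Integrating out \<open>k\<close> gives the posterior density of \<open>\<theta>\<close>; factoring out the
  \<open>\<theta>\<close>-integral \<open>m\<^sub>\<pi>(k)\<close> first writes the same joint density as \<open>\<pi>\<^sub>k(\<theta>) f'\<^sub>x(k)\<close>, which is (a).
  The factorisation can fail only where \<open>m\<^sub>\<pi>(k)\<close> is zero or infinite. In the first case the weight
  vanishes for almost every \<open>\<theta>\<close>; in the second, finiteness of the normalising constant forces
  \<open>f\<^sub>k(x) = 0\<close> for almost every such \<open>k\<close>. So the identity holds almost everywhere, whatever the
  densities chosen in place of \<open>\<pi>\<^sub>k\<close> at those \<open>k\<close> (\<open>AE_component_times_f_prime\<close>,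
  \<open>posterior_eq_mixture\<close>).

  For (b), forming mixtures is associative (\<open>mixture_density_assoc\<close>, which is Tonelli's theorem).
  The predictive density mixes, over the posterior, the mixtures of the \<open>q\<^sub>j\<close> by \<open>h\<^sub>\<theta>\<close>; reassociating,
  it is the mixture of the \<open>q\<^sub>j\<close> by the posterior mixture of the \<open>h\<^sub>\<theta>\<close>. Inserting (a) and reassociating
  once more identifies that mixing density as \<open>h'\<^sub>x\<close> (\<open>h_prime_eq_mixture_over_posterior\<close>,
  \<open>predictive_eq_mixture\<close>).

  That posterior and predictive densities really are conditional densities given \<open>X\<close> follows because
  in both cases the joint density with \<open>X\<close> is the normalising constant, a function of \<open>x\<close> alone, times
  the candidate (\<open>conditional_density_onI\<close>). This works for improper priors too, since only regular
  \<open>x\<close> are conditioned on.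
\<close>

section \<open>Mixtures of densities\<close>

lemma prob_density_AE_cong:
  assumes "prob_density N p" and "p' \<in> borel_measurable N" and "AE z in N. p' z = p z"
  shows "prob_density N p'"
  using assms nn_integral_cong_AE[of p' p N] by (simp add: prob_density_def)

lemma prob_density_mixture_density:
  assumes "sigma_finite_measure \<mu>" and "sigma_finite_measure N"
    and p_meas: "(\<lambda>(k, z). p k z) \<in> borel_measurable (\<mu> \<Otimes>\<^sub>M N)"
    and p: "\<And>k. k \<in> space \<mu> \<Longrightarrow> prob_density N (p k)"
    and r: "prob_density \<mu> r"
  shows "prob_density N (mixture_density \<mu> r p)"
proof -
  interpret \<mu>: sigma_finite_measure \<mu> by fact
  interpret N: sigma_finite_measure N by fact
  interpret P: pair_sigma_finite \<mu> N ..
  note [measurable] = p_meas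
  have [measurable]: "r \<in> borel_measurable \<mu>"
    using r by (simp add: prob_density_def)
  have "(\<integral>\<^sup>+ z. \<integral>\<^sup>+ k. p k z * r k \<partial>\<mu> \<partial>N) = (\<integral>\<^sup>+ k. \<integral>\<^sup>+ z. p k z * r k \<partial>N \<partial>\<mu>)"
    by (rule P.Fubini') measurable
  also have "\<dots> = (\<integral>\<^sup>+ k. r k \<partial>\<mu>)"
    using p by (intro nn_integral_cong) (simp add: nn_integral_multc prob_density_def)
  also have "\<dots> = 1"
    using r by (simp add: prob_density_def)
  finally show ?thesis
    unfolding prob_density_def mixture_density_def by simp
qed

text \<open>
  A two-stage mixture can be collapsed from either end; pointwise in \<open>z\<close> this is an exchange of
  integrals. It turns a statement about the mixing densities into one about the mixed densities.
\<close>
lemma mixture_density_assoc: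
  assumes "sigma_finite_measure \<mu>" and "sigma_finite_measure \<tau>"
    and [measurable]: "r \<in> borel_measurable \<mu>"
    and [measurable]: "(\<lambda>(k, t). s k t) \<in> borel_measurable (\<mu> \<Otimes>\<^sub>M \<tau>)"
    and [measurable]: "(\<lambda>t. p t z) \<in> borel_measurable \<tau>"
  shows "mixture_density \<mu> r (\<lambda>k. mixture_density \<tau> (s k) p) z =
    mixture_density \<tau> (mixture_density \<mu> r s) p z"
proof -
  interpret \<mu>: sigma_finite_measure \<mu> by fact
  interpret \<tau>: sigma_finite_measure \<tau> by fact
  interpret P: pair_sigma_finite \<mu> \<tau> ..
  have "(\<integral>\<^sup>+ k. (\<integral>\<^sup>+ t. p t z * s k t \<partial>\<tau>) * r k \<partial>\<mu>) =
      (\<integral>\<^sup>+ k. \<integral>\<^sup>+ t. p t z * (s k t * r k) \<partial>\<tau> \<partial>\<mu>)"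
    by (intro nn_integral_cong) (simp add: nn_integral_multc[symmetric] mult.assoc)
  also have "\<dots> = (\<integral>\<^sup>+ t. \<integral>\<^sup>+ k. p t z * (s k t * r k) \<partial>\<mu> \<partial>\<tau>)"
    by (rule P.Fubini'[symmetric]) measurable
  also have "\<dots> = (\<integral>\<^sup>+ t. p t z * (\<integral>\<^sup>+ k. s k t * r k \<partial>\<mu>) \<partial>\<tau>)"
    by (intro nn_integral_cong) (simp add: nn_integral_cmult)
  finally show ?thesis
    by (simp add: mixture_density_def)
qed

text \<open>
  A measure is determined by its integrals of indicators, and for a coordinate projection \<open>t\<close>
  integrating out the remaining coordinates computes exactly these.
\<close>
lemma distributed_map:
  assumes Z: "distributed M N Z f"
    and [measurable]: "t \<in> N \<rightarrow>\<^sub>M N'" "f' \<in> borel_measurable N'"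
    and f': "\<And>A. A \<in> sets N' \<Longrightarrow> (\<integral>\<^sup>+ z. f z * indicator A (t z) \<partial>N) = (\<integral>\<^sup>+ z. f' z * indicator A z \<partial>N')"
  shows "distributed M N' (\<lambda>\<omega>. t (Z \<omega>)) f'"
proof -
  note [measurable] = distributed_measurable[OF Z] distributed_borel_measurable[OF Z]
  have "distr M N' (\<lambda>\<omega>. t (Z \<omega>)) = density N' f'"
  proof (rule measure_eqI)
    fix A assume "A \<in> sets (distr M N' (\<lambda>\<omega>. t (Z \<omega>)))"
    then have A [measurable]: "A \<in> sets N'" by simp
    have "emeasure (distr M N' (\<lambda>\<omega>. t (Z \<omega>))) A = (\<integral>\<^sup>+ \<omega>. indicator A (t (Z \<omega>)) \<partial>M)"
      using nn_integral_distr[of "\<lambda>\<omega>. t (Z \<omega>)" M N' "indicator A"] by simp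
    also have "\<dots> = (\<integral>\<^sup>+ z. f z * indicator A (t z) \<partial>N)"
      by (rule distributed_nn_integral[OF Z, symmetric]) measurable
    also have "\<dots> = emeasure (density N' f') A"
      by (simp add: f' emeasure_density)
    finally show "emeasure (distr M N' (\<lambda>\<omega>. t (Z \<omega>))) A = emeasure (density N' f') A" .
  qed simp
  then show ?thesis
    by (simp add: distributed_def)
qed

text \<open>
  The canonical model: \<open>\<mu> \<Otimes> N\<close> weighted by the joint density, with the coordinate projections as random
  elements. The marginals are found by integrating out one coordinate.
\<close>
lemma mixture_representation_exists:
  fixes \<mu> :: "'k measure" and N :: "'a measure"
  assumes "sigma_finite_measure \<mu>" and "sigma_finite_measure N"
    and p_meas: "(\<lambda>(k, z). p k z) \<in> borel_measurable (\<mu> \<Otimes>\<^sub>M N)"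
    and p: "\<And>k. k \<in> space \<mu> \<Longrightarrow> prob_density N (p k)"
    and r: "prob_density \<mu> r"
  shows "\<exists>(\<Omega> :: ('k \<times> 'a) measure) L Z.
    mixture_representation \<Omega> \<mu> L r N Z p \<and> distributed \<Omega> N Z (mixture_density \<mu> r p)"
proof -
  interpret \<mu>: sigma_finite_measure \<mu> by fact
  interpret N: sigma_finite_measure N by fact
  interpret P: pair_sigma_finite \<mu> N ..
  note [measurable] = p_meas
  have [measurable]: "r \<in> borel_measurable \<mu>"
    using r by (simp add: prob_density_def)
  define \<Omega> where "\<Omega> = density (\<mu> \<Otimes>\<^sub>M N) (\<lambda>(k, z). r k * p k z)"
  have joint: "distributed \<Omega> (\<mu> \<Otimes>\<^sub>M N) (\<lambda>\<omega>. \<omega>) (\<lambda>(k, z). r k * p k z)"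
    by (simp add: distributed_def \<Omega>_def distr_id2)
  have fst: "distributed \<Omega> \<mu> fst r"
  proof (rule distributed_map[OF joint])
    fix A assume [measurable]: "A \<in> sets \<mu>"
    have "(\<integral>\<^sup>+ z. (case z of (k, z) \<Rightarrow> r k * p k z) * indicator A (fst z) \<partial>(\<mu> \<Otimes>\<^sub>M N)) =
        (\<integral>\<^sup>+ k. \<integral>\<^sup>+ z. r k * indicator A k * p k z \<partial>N \<partial>\<mu>)"
      by (subst N.nn_integral_fst[symmetric]) (auto intro!: nn_integral_cong simp: ac_simps)
    also have "\<dots> = (\<integral>\<^sup>+ k. r k * indicator A k \<partial>\<mu>)"
      using p by (intro nn_integral_cong) (simp add: nn_integral_cmult prob_density_def)
    finally show "(\<integral>\<^sup>+ z. (case z of (k, z) \<Rightarrow> r k * p k z) * indicator A (fst z) \<partial>(\<mu> \<Otimes>\<^sub>M N)) =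
        (\<integral>\<^sup>+ k. r k * indicator A k \<partial>\<mu>)" .
  qed measurable
  have snd: "distributed \<Omega> N snd (mixture_density \<mu> r p)"
  proof (rule distributed_map[OF joint])
    fix A assume [measurable]: "A \<in> sets N"
    have "(\<integral>\<^sup>+ z. (case z of (k, z) \<Rightarrow> r k * p k z) * indicator A (snd z) \<partial>(\<mu> \<Otimes>\<^sub>M N)) =
        (\<integral>\<^sup>+ z. \<integral>\<^sup>+ k. p k z * r k * indicator A z \<partial>\<mu> \<partial>N)"
      by (subst P.nn_integral_snd[symmetric]) (auto intro!: nn_integral_cong simp: ac_simps)
    also have "\<dots> = (\<integral>\<^sup>+ z. mixture_density \<mu> r p z * indicator A z \<partial>N)"
      unfolding mixture_density_def by (intro nn_integral_cong) (simp add: nn_integral_multc)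
    finally show "(\<integral>\<^sup>+ z. (case z of (k, z) \<Rightarrow> r k * p k z) * indicator A (snd z) \<partial>(\<mu> \<Otimes>\<^sub>M N)) =
        (\<integral>\<^sup>+ z. mixture_density \<mu> r p z * indicator A z \<partial>N)" .
  qed (use prob_density_mixture_density[OF assms] in \<open>simp_all add: prob_density_def\<close>)
  have "emeasure \<Omega> (space \<Omega>) = emeasure (distr \<Omega> \<mu> fst) (space \<mu>)"
    using distributed_measurable[OF fst] by (subst emeasure_distr) (auto dest: measurable_space intro!: arg_cong[where f = "emeasure \<Omega>"])
  also have "\<dots> = 1"
    using r by (simp add: distributed_distr_eq_density[OF fst] emeasure_density prob_density_def
      cong: nn_integral_cong)
  finally have "prob_space \<Omega>"
    by (rule prob_spaceI)
  with fst joint p r have "mixture_representation \<Omega> \<mu> fst r N snd p"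
    by (simp add: mixture_representation_def)
  with snd show ?thesis by blast
qed

section \<open>Conditional densities from joint densities\<close>

text \<open>
  A joint density that factors as a function of \<open>x\<close> times a probability density in \<open>z\<close> has the latter
  as conditional density. The factor \<open>c\<close> is the marginal density of \<open>X\<close> on \<open>G\<close>. Both sides of the
  defining equation are integrated against the joint density, and \<open>c\<close> is handled only under the inner
  integral, where \<open>x\<close> is fixed and \<open>c x\<close> is a constant.
\<close>
lemma conditional_density_onI:
  assumes "sigma_finite_measure N"
    and joint: "distributed M (L \<Otimes>\<^sub>M N) (\<lambda>\<omega>. (X \<omega>, Z \<omega>)) (\<lambda>(x, z). j x z)"
    and p_meas: "(\<lambda>(x, z). p x z) \<in> borel_measurable (L \<Otimes>\<^sub>M N)"
    and p: "\<And>x. x \<in> G \<Longrightarrow> prob_density N (p x)"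
    and j: "\<And>x z. x \<in> G \<Longrightarrow> z \<in> space N \<Longrightarrow> j x z = c x * p x z"
  shows "conditional_density_on G M L X N Z p"
proof -
  interpret N: sigma_finite_measure N by fact
  note [measurable] = p_meas
  have [measurable]: "(\<lambda>(x, z). j x z) \<in> borel_measurable (L \<Otimes>\<^sub>M N)"
    and [measurable]: "(\<lambda>\<omega>. (X \<omega>, Z \<omega>)) \<in> M \<rightarrow>\<^sub>M L \<Otimes>\<^sub>M N"
    using joint by (simp_all add: distributed_def)
  have "emeasure M {\<omega> \<in> space M. X \<omega> \<in> B \<and> Z \<omega> \<in> A} =
      (\<integral>\<^sup>+ \<omega>. (\<integral>\<^sup>+ z\<in>A. p (X \<omega>) z \<partial>N) * indicator B (X \<omega>) \<partial>M)"
    if [measurable]: "A \<in> sets N" "B \<in> sets L" and "B \<subseteq> G" for A B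
  proof -
    define F where "F x = (\<integral>\<^sup>+ z\<in>A. p x z \<partial>N) * indicator B x" for x
    have [measurable]: "F \<in> borel_measurable L"
      unfolding F_def[abs_def] by measurable
    \<comment> \<open>Both sides are \<open>c x * F x\<close>: on the left by definition of \<open>F\<close>, on the right because \<open>F x\<close> does
      not depend on \<open>z\<close> and \<open>p x\<close> has total mass one.\<close>
    have inner: "(\<integral>\<^sup>+ z. j x z * indicator (B \<times> A) (x, z) \<partial>N) = (\<integral>\<^sup>+ z. j x z * F x \<partial>N)"
      if "x \<in> space L" for x
    proof (cases "x \<in> B")
      case True
      with \<open>B \<subseteq> G\<close> have "x \<in> G" by auto
      note [measurable] = measurable_Pair2[OF p_meas that, simplified]
      have "(\<integral>\<^sup>+ z. j x z * indicator (B \<times> A) (x, z) \<partial>N) = (\<integral>\<^sup>+ z. c x * (p x z * indicator A z) \<partial>N)"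
        using True \<open>x \<in> G\<close> by (intro nn_integral_cong) (simp add: j indicator_def)
      also have "\<dots> = c x * F x"
        using True by (simp add: nn_integral_cmult F_def)
      also have "\<dots> = (\<integral>\<^sup>+ z. c x * F x * p x z \<partial>N)"
        using p[OF \<open>x \<in> G\<close>] by (simp add: nn_integral_cmult prob_density_def)
      also have "\<dots> = (\<integral>\<^sup>+ z. j x z * F x \<partial>N)"
        using \<open>x \<in> G\<close> by (intro nn_integral_cong) (simp add: j ac_simps)
      finally show ?thesis .
    qed (simp add: F_def)
    have "emeasure M {\<omega> \<in> space M. X \<omega> \<in> B \<and> Z \<omega> \<in> A} =
        emeasure (distr M (L \<Otimes>\<^sub>M N) (\<lambda>\<omega>. (X \<omega>, Z \<omega>))) (B \<times> A)"
      by (subst emeasure_distr) (auto intro!: arg_cong[where f = "emeasure M"])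
    also have "\<dots> = (\<integral>\<^sup>+ x. \<integral>\<^sup>+ z. j x z * indicator (B \<times> A) (x, z) \<partial>N \<partial>L)"
      by (simp add: distributed_distr_eq_density[OF joint] emeasure_density N.nn_integral_fst[symmetric])
    also have "\<dots> = (\<integral>\<^sup>+ x. \<integral>\<^sup>+ z. j x z * F x \<partial>N \<partial>L)"
      by (intro nn_integral_cong inner)
    also have "\<dots> = (\<integral>\<^sup>+ v. (case v of (x, z) \<Rightarrow> j x z) * F (fst v) \<partial>(L \<Otimes>\<^sub>M N))"
      by (subst N.nn_integral_fst[symmetric]) simp_all
    also have "\<dots> = (\<integral>\<^sup>+ \<omega>. F (X \<omega>) \<partial>M)"
      by (subst distributed_nn_integral[OF joint]) simp_all
    finally show ?thesis
      by (simp add: F_def)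
  qed
  with p_meas p show ?thesis
    by (simp add: conditional_density_on_def)
qed


section \<open>The posterior as a mixture\<close>

locale mixture_prior =
  fixes \<mu> :: "'k measure" and \<tau> :: "'t measure" and \<nu> :: "'x measure"
    and prior :: "'t \<Rightarrow> ennreal" and g :: "'t \<Rightarrow> 'k \<Rightarrow> ennreal"
    and f :: "'k \<Rightarrow> 'x \<Rightarrow> ennreal" and \<rho> :: "'k \<Rightarrow> 't \<Rightarrow> ennreal"
  assumes sigma_finite_\<mu>: "sigma_finite_measure \<mu>"
    and sigma_finite_\<tau>: "sigma_finite_measure \<tau>"
    and sigma_finite_\<nu>: "sigma_finite_measure \<nu>"
    and prior_measurable [measurable]: "prior \<in> borel_measurable \<tau>"
    and g_measurable [measurable]: "(\<lambda>(\<theta>, k). g \<theta> k) \<in> borel_measurable (\<tau> \<Otimes>\<^sub>M \<mu>)"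
    and f_measurable [measurable]: "(\<lambda>(k, x). f k x) \<in> borel_measurable (\<mu> \<Otimes>\<^sub>M \<nu>)"
    and \<rho>_measurable [measurable]: "(\<lambda>(k, \<theta>). \<rho> k \<theta>) \<in> borel_measurable (\<mu> \<Otimes>\<^sub>M \<tau>)"
    and \<rho>_density: "\<And>k. k \<in> space \<mu> \<Longrightarrow> prob_density \<tau> (\<rho> k)"
begin

sublocale \<mu>: sigma_finite_measure \<mu> by (rule sigma_finite_\<mu>)
sublocale \<tau>: sigma_finite_measure \<tau> by (rule sigma_finite_\<tau>)
sublocale \<nu>: sigma_finite_measure \<nu> by (rule sigma_finite_\<nu>)
sublocale \<mu>\<tau>: pair_sigma_finite \<mu> \<tau> ..

abbreviation "m \<equiv> m_prior \<tau> prior g"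
abbreviation "C \<equiv> norm_const \<mu> \<tau> prior g f"
abbreviation "G \<equiv> regular_points \<mu> \<tau> prior g f"
abbreviation "f' \<equiv> f_prime \<mu> \<tau> prior g f"
abbreviation "component \<equiv> pi_comp \<tau> prior g \<rho>"
abbreviation "posterior \<equiv> posterior_density \<mu> \<tau> prior g f"

lemma m_measurable [measurable]: "m \<in> borel_measurable \<mu>"
  unfolding m_prior_def[abs_def] by measurable

lemma norm_const_measurable [measurable]: "C \<in> borel_measurable \<nu>"
  unfolding norm_const_def[abs_def] by measurable

lemma f_prime_measurable [measurable]: "(\<lambda>(x, k). f' x k) \<in> borel_measurable (\<nu> \<Otimes>\<^sub>M \<mu>)"
  unfolding f_prime_def by measurable

lemma component_measurable [measurable]:
  "(\<lambda>(k, \<theta>). component k \<theta>) \<in> borel_measurable (\<mu> \<Otimes>\<^sub>M \<tau>)"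
  unfolding pi_comp_def by measurable

lemma likelihood_measurable [measurable]:
  "(\<lambda>(\<theta>, x). mixture_density \<mu> (g \<theta>) f x) \<in> borel_measurable (\<tau> \<Otimes>\<^sub>M \<nu>)"
  unfolding mixture_density_def by measurable

lemma posterior_measurable [measurable]:
  "(\<lambda>(x, \<theta>). posterior x \<theta>) \<in> borel_measurable (\<nu> \<Otimes>\<^sub>M \<tau>)"
  unfolding posterior_density_def by measurable

lemma marginal_density_eq_norm_const:
  assumes [measurable]: "x \<in> space \<nu>"
  shows "(\<integral>\<^sup>+ \<theta>. prior \<theta> * mixture_density \<mu> (g \<theta>) f x \<partial>\<tau>) = C x"
proof -
  have "(\<integral>\<^sup>+ \<theta>. prior \<theta> * mixture_density \<mu> (g \<theta>) f x \<partial>\<tau>) =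
      (\<integral>\<^sup>+ \<theta>. \<integral>\<^sup>+ k. f k x * (g \<theta> k * prior \<theta>) \<partial>\<mu> \<partial>\<tau>)"
    unfolding mixture_density_def
    by (intro nn_integral_cong) (simp add: nn_integral_cmult[symmetric] ac_simps)
  also have "\<dots> = (\<integral>\<^sup>+ k. \<integral>\<^sup>+ \<theta>. f k x * (g \<theta> k * prior \<theta>) \<partial>\<tau> \<partial>\<mu>)"
    by (rule \<mu>\<tau>.Fubini') measurable
  also have "\<dots> = C x"
    unfolding norm_const_def m_prior_def
    by (intro nn_integral_cong) (simp add: nn_integral_cmult)
  finally show ?thesis .
qed

text \<open>
  Bayes' rule without the division: the form in which it matches a joint density. It rests on the
  normalising constant being neither zero nor infinite.
\<close>
lemma prior_times_likelihood:
  assumes "x \<in> space \<nu>" and "x \<in> G"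
  shows "prior \<theta> * mixture_density \<mu> (g \<theta>) f x = C x * posterior x \<theta>"
proof -
  have "C x \<noteq> 0" "C x \<noteq> top"
    using assms by (auto simp: regular_points_def)
  then show ?thesis
    using assms by (simp add: posterior_density_def marginal_density_eq_norm_const
      ennreal_times_divide ennreal_mult_divide_eq mult.commute[of "C x"])
qed

lemma prob_density_f_prime:
  assumes [measurable]: "x \<in> space \<nu>" and "x \<in> G"
  shows "prob_density \<mu> (f' x)"
proof -
  have "(\<integral>\<^sup>+ k. f' x k \<partial>\<mu>) = C x / C x"
    unfolding f_prime_def by (simp add: nn_integral_divide norm_const_def)
  with assms(2) show ?thesis
    by (auto simp: prob_density_def regular_points_def)
qed

lemma prob_density_component:
  assumes [measurable]: "k \<in> space \<mu>"
  shows "prob_density \<tau> (component k)"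
proof (cases "0 < m k \<and> m k < \<infinity>")
  case True
  have "(\<integral>\<^sup>+ \<theta>. component k \<theta> \<partial>\<tau>) = (\<integral>\<^sup>+ \<theta>. g \<theta> k * prior \<theta> \<partial>\<tau>) / m k"
    using True by (simp add: pi_comp_def nn_integral_divide mult.commute)
  also have "\<dots> = 1"
    using True by (auto simp: m_prior_def[symmetric])
  finally show ?thesis
    by (simp add: prob_density_def)
next
  case False
  then have "component k = \<rho> k"
    by (auto simp: pi_comp_def)
  then show ?thesis
    using \<rho>_density[OF assms] by simp
qed

text \<open>
  The two factorisations of the joint density of \<open>(k, \<theta>)\<close> given \<open>x\<close>. For a fixed \<open>k\<close> the exceptional
  \<open>\<theta>\<close> depend on \<open>k\<close>, so the argument runs through the \<open>k\<close>-sections, and Fubini's theorem for null sets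
  then exchanges the quantifiers.
\<close>
lemma AE_component_times_f_prime:
  assumes x [measurable]: "x \<in> space \<nu>" and G: "x \<in> G"
  shows "AE \<theta> in \<tau>. AE k in \<mu>. component k \<theta> * f' x k = f k x * g \<theta> k * prior \<theta> / C x"
proof -
  have C: "C x \<noteq> 0" "C x \<noteq> \<infinity>"
    using G by (auto simp: regular_points_def)
  have "AE k in \<mu>. f k x * m k \<noteq> \<infinity>"
    by (rule nn_integral_PInf_AE) (use C in \<open>simp_all add: norm_const_def\<close>)
  moreover have "AE \<theta> in \<tau>. component k \<theta> * f' x k = f k x * g \<theta> k * prior \<theta> / C x"
    if k [measurable]: "k \<in> space \<mu>" and fin: "f k x * m k \<noteq> \<infinity>" for k
  proof -
    consider "f k x = 0" | "m k = 0" | "m k \<noteq> 0" "m k \<noteq> \<infinity>"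
      using fin by (auto simp: ennreal_mult_eq_top_iff)
    then show ?thesis
    proof cases
      case 1
      then show ?thesis by (simp add: f_prime_def)
    next
      case 2
      \<comment> \<open>The right-hand side need not vanish for every \<open>\<theta>\<close>, but its \<open>\<theta>\<close>-integral is a multiple of \<open>m k\<close>.\<close>
      have "AE \<theta> in \<tau>. g \<theta> k * prior \<theta> = 0"
        using 2 by (subst nn_integral_0_iff_AE[symmetric]) (simp_all add: m_prior_def)
      then show ?thesis
        using 2 by (auto simp: f_prime_def mult.assoc simp del: mult_eq_0_iff)
    next
      case 3
      have "component k \<theta> * f' x k = f k x * g \<theta> k * prior \<theta> / C x" for \<theta>
      proof -
        have "component k \<theta> * f' x k = (prior \<theta> * g \<theta> k / m k * m k) * f k x / C x"
          using 3 by (simp add: pi_comp_def f_prime_def ennreal_times_divide less_top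
            zero_less_iff_neq_zero mult.commute mult.left_commute)
        also have "prior \<theta> * g \<theta> k / m k * m k = prior \<theta> * g \<theta> k"
          using 3 by (simp add: ennreal_divide_times less_top)
        finally show ?thesis by (simp add: ac_simps)
      qed
      then show ?thesis by simp
    qed
  qed
  ultimately have "AE k in \<mu>. AE \<theta> in \<tau>. component k \<theta> * f' x k = f k x * g \<theta> k * prior \<theta> / C x"
    by (auto)
  then show ?thesis
    by (subst (asm) \<mu>\<tau>.AE_commute) simp_all
qed

lemma posterior_eq_mixture:
  assumes x [measurable]: "x \<in> space \<nu>" and G: "x \<in> G"
  shows "AE \<theta> in \<tau>. posterior x \<theta> = mixture_density \<mu> (f' x) component \<theta>"
  using AE_component_times_f_prime[OF x G] AE_space
proof eventually_elim
  case (elim \<theta>)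
  note [measurable] = elim(2)
  have "mixture_density \<mu> (f' x) component \<theta> = (\<integral>\<^sup>+ k. f k x * g \<theta> k * prior \<theta> / C x \<partial>\<mu>)"
    unfolding mixture_density_def by (rule nn_integral_cong_AE) (rule elim(1))
  also have "\<dots> = posterior x \<theta>"
    by (simp add: posterior_density_def marginal_density_eq_norm_const[OF x] nn_integral_divide
      nn_integral_multc mult.commute[of "prior \<theta>"]) (simp add: mixture_density_def)
  finally show ?case ..
qed

text \<open>The total mass is one because the mixture in (a) has total mass one.\<close>
lemma prob_density_posterior:
  assumes x [measurable]: "x \<in> space \<nu>" and G: "x \<in> G"
  shows "prob_density \<tau> (posterior x)"
proof (rule prob_density_AE_cong)
  show "prob_density \<tau> (mixture_density \<mu> (f' x) component)"
    by (rule prob_density_mixture_density[OF sigma_finite_\<mu> sigma_finite_\<tau> component_measurable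
        prob_density_component prob_density_f_prime[OF x G]])
qed (simp, rule posterior_eq_mixture[OF x G])

text \<open>Integrating out the mixing variable \<open>K\<close> turns \<open>f\<^sub>K\<close> into the likelihood of \<open>\<theta>\<close>.\<close>
lemma joint_density_observation_parameter:
  assumes joint: "distributed M (\<tau> \<Otimes>\<^sub>M \<mu> \<Otimes>\<^sub>M \<nu>) (\<lambda>\<omega>. (T \<omega>, K \<omega>, X \<omega>)) (\<lambda>(\<theta>, k, x). prior \<theta> * g \<theta> k * f k x)"
  shows "distributed M (\<nu> \<Otimes>\<^sub>M \<tau>) (\<lambda>\<omega>. (X \<omega>, T \<omega>)) (\<lambda>(x, \<theta>). prior \<theta> * mixture_density \<mu> (g \<theta>) f x)"
proof -
  interpret \<mu>\<nu>: pair_sigma_finite \<mu> \<nu> ..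
  interpret \<tau>\<nu>: pair_sigma_finite \<tau> \<nu> ..
  have "distributed M (\<nu> \<Otimes>\<^sub>M \<tau>) (\<lambda>\<omega>. (\<lambda>(\<theta>, k, x). (x, \<theta>)) (T \<omega>, K \<omega>, X \<omega>))
      (\<lambda>(x, \<theta>). prior \<theta> * mixture_density \<mu> (g \<theta>) f x)"
  proof (rule distributed_map[OF joint])
    fix A assume [measurable]: "A \<in> sets (\<nu> \<Otimes>\<^sub>M \<tau>)"
    have "(\<integral>\<^sup>+ v. (case v of (\<theta>, k, x) \<Rightarrow> prior \<theta> * g \<theta> k * f k x) *
          indicator A (case v of (\<theta>, k, x) \<Rightarrow> (x, \<theta>)) \<partial>(\<tau> \<Otimes>\<^sub>M \<mu> \<Otimes>\<^sub>M \<nu>)) =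
        (\<integral>\<^sup>+ \<theta>. \<integral>\<^sup>+ k. \<integral>\<^sup>+ x. prior \<theta> * indicator A (x, \<theta>) * (f k x * g \<theta> k) \<partial>\<nu> \<partial>\<mu> \<partial>\<tau>)"
      by (subst \<mu>\<nu>.nn_integral_fst[symmetric], simp, intro nn_integral_cong,
          subst \<nu>.nn_integral_fst[symmetric]) (auto intro!: nn_integral_cong simp: ac_simps)
    also have "\<dots> = (\<integral>\<^sup>+ \<theta>. \<integral>\<^sup>+ x. \<integral>\<^sup>+ k. prior \<theta> * indicator A (x, \<theta>) * (f k x * g \<theta> k) \<partial>\<mu> \<partial>\<nu> \<partial>\<tau>)"
      by (intro nn_integral_cong \<mu>\<nu>.Fubini'[symmetric]) measurable
    also have "\<dots> = (\<integral>\<^sup>+ \<theta>. \<integral>\<^sup>+ x. prior \<theta> * mixture_density \<mu> (g \<theta>) f x * indicator A (x, \<theta>) \<partial>\<nu> \<partial>\<tau>)"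
      by (intro nn_integral_cong) (simp add: nn_integral_cmult, simp add: mixture_density_def ac_simps)
    also have "\<dots> = (\<integral>\<^sup>+ x. \<integral>\<^sup>+ \<theta>. prior \<theta> * mixture_density \<mu> (g \<theta>) f x * indicator A (x, \<theta>) \<partial>\<tau> \<partial>\<nu>)"
      by (rule \<tau>\<nu>.Fubini'[symmetric]) measurable
    also have "\<dots> = (\<integral>\<^sup>+ v. (case v of (x, \<theta>) \<Rightarrow> prior \<theta> * mixture_density \<mu> (g \<theta>) f x) * indicator A v
        \<partial>(\<nu> \<Otimes>\<^sub>M \<tau>))"
      by (subst \<tau>.nn_integral_fst[symmetric]) simp_all
    finally show "(\<integral>\<^sup>+ v. (case v of (\<theta>, k, x) \<Rightarrow> prior \<theta> * g \<theta> k * f k x) *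
          indicator A (case v of (\<theta>, k, x) \<Rightarrow> (x, \<theta>)) \<partial>(\<tau> \<Otimes>\<^sub>M \<mu> \<Otimes>\<^sub>M \<nu>)) =
        (\<integral>\<^sup>+ v. (case v of (x, \<theta>) \<Rightarrow> prior \<theta> * mixture_density \<mu> (g \<theta>) f x) * indicator A v
          \<partial>(\<nu> \<Otimes>\<^sub>M \<tau>))" .
  qed measurable
  then show ?thesis by simp
qed

lemma posterior_conditional_density:
  assumes joint: "distributed M (\<tau> \<Otimes>\<^sub>M \<mu> \<Otimes>\<^sub>M \<nu>) (\<lambda>\<omega>. (T \<omega>, K \<omega>, X \<omega>)) (\<lambda>(\<theta>, k, x). prior \<theta> * g \<theta> k * f k x)"
    and G: "G \<subseteq> space \<nu>"
  shows "conditional_density_on G M \<nu> X \<tau> T posterior"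
  by (rule conditional_density_onI[OF sigma_finite_\<tau> joint_density_observation_parameter[OF joint]
        posterior_measurable])
    (use G in \<open>auto intro: prob_density_posterior prior_times_likelihood\<close>)

end

section \<open>The predictive density as a mixture\<close>

locale predictive_mixture = mixture_prior \<mu> \<tau> \<nu> prior g f \<rho>
  for \<mu> :: "'k measure" and \<tau> :: "'t measure" and \<nu> :: "'x measure"
    and prior g and f :: "'k \<Rightarrow> 'x \<Rightarrow> ennreal" and \<rho> +
  fixes N :: "'y measure" and h :: "'t \<Rightarrow> 'k \<Rightarrow> ennreal" and q :: "'k \<Rightarrow> 'y \<Rightarrow> ennreal"
  assumes sigma_finite_N: "sigma_finite_measure N"
    and h_measurable [measurable]: "(\<lambda>(\<theta>, j). h \<theta> j) \<in> borel_measurable (\<tau> \<Otimes>\<^sub>M \<mu>)"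
    and h_density: "\<And>\<theta>. \<theta> \<in> space \<tau> \<Longrightarrow> prob_density \<mu> (h \<theta>)"
    and q_measurable [measurable]: "(\<lambda>(j, y). q j y) \<in> borel_measurable (\<mu> \<Otimes>\<^sub>M N)"
    and q_density: "\<And>j. j \<in> space \<mu> \<Longrightarrow> prob_density N (q j)"
begin

sublocale N: sigma_finite_measure N by (rule sigma_finite_N)

abbreviation "predictive \<equiv> predictive_density \<mu> \<tau> prior g h f q"
abbreviation "h' \<equiv> h_prime \<mu> \<tau> prior g h \<rho> f"

text \<open>
  The three identities below put the defining integrals into the form to which
  \<open>mixture_density_assoc\<close> applies.
\<close>
lemma predictive_eq: "predictive x = mixture_density \<tau> (posterior x) (\<lambda>\<theta>. mixture_density \<mu> (h \<theta>) q)"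
  by (simp add: fun_eq_iff predictive_density_def mixture_density_def)

lemma mixing_predictive_eq:
  "mixing_predictive \<tau> prior g h \<rho> k = mixture_density \<tau> (component k) h"
  by (simp add: fun_eq_iff mixing_predictive_def mixture_density_def)

lemma h_prime_eq: "h' x = mixture_density \<mu> (f' x) (\<lambda>k. mixture_density \<tau> (component k) h)"
  by (simp add: fun_eq_iff h_prime_def mixing_predictive_eq mixture_density_def)

lemma sampling_density_measurable [measurable]:
  "(\<lambda>(\<theta>, y). mixture_density \<mu> (h \<theta>) q y) \<in> borel_measurable (\<tau> \<Otimes>\<^sub>M N)"
  unfolding mixture_density_def by measurable

lemma predictive_measurable [measurable]:
  "(\<lambda>(x, y). predictive x y) \<in> borel_measurable (\<nu> \<Otimes>\<^sub>M N)"
  unfolding predictive_density_def by measurable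

lemma prob_density_predictive:
  assumes "x \<in> space \<nu>" and "x \<in> G"
  shows "prob_density N (predictive x)"
  unfolding predictive_eq
  by (intro prob_density_mixture_density[OF sigma_finite_\<tau> sigma_finite_N]
      prob_density_mixture_density[OF sigma_finite_\<mu> sigma_finite_N]
      prob_density_posterior sampling_density_measurable q_measurable h_density q_density assms)

text \<open>
  \<open>h'\<^sub>x\<close> is the density of the mixing variable \<open>J\<close> given \<open>X = x\<close>: averaging \<open>h\<^sub>\<theta>\<close> over \<open>\<pi>\<^sub>k\<close> and then
  over \<open>f'\<^sub>x\<close> is averaging over the mixture of the \<open>\<pi>\<^sub>k\<close>, which is the posterior. The exceptional
  \<open>\<theta>\<close> of the representation (a) do not affect the integral, so equality holds at every \<open>j\<close>.
\<close>
lemma h_prime_eq_mixture_over_posterior: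
  assumes x [measurable]: "x \<in> space \<nu>" and G: "x \<in> G" and [measurable]: "j \<in> space \<mu>"
  shows "h' x j = mixture_density \<tau> (posterior x) h j"
proof -
  have "h' x j = mixture_density \<tau> (mixture_density \<mu> (f' x) component) h j"
    unfolding h_prime_eq by (rule mixture_density_assoc[OF sigma_finite_\<mu> sigma_finite_\<tau>]) measurable
  also have "\<dots> = mixture_density \<tau> (posterior x) h j"
    unfolding mixture_density_def[of \<tau>]
    by (rule nn_integral_cong_AE) (use posterior_eq_mixture[OF x G] in \<open>auto\<close>)
  finally show ?thesis .
qed

lemma h_prime_measurable [measurable]: "x \<in> space \<nu> \<Longrightarrow> h' x \<in> borel_measurable \<mu>"
  unfolding h_prime_def[abs_def] mixing_predictive_def by measurable

lemma prob_density_h_prime: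
  assumes x [measurable]: "x \<in> space \<nu>" and G: "x \<in> G"
  shows "prob_density \<mu> (h' x)"
proof (rule prob_density_AE_cong)
  show "prob_density \<mu> (mixture_density \<tau> (posterior x) h)"
    by (intro prob_density_mixture_density[OF sigma_finite_\<tau> sigma_finite_\<mu>]
        prob_density_posterior h_measurable h_density x G)
qed (simp_all add: h_prime_eq_mixture_over_posterior[OF x G])

lemma predictive_eq_mixture:
  assumes x [measurable]: "x \<in> space \<nu>" and G: "x \<in> G" and [measurable]: "y \<in> space N"
  shows "predictive x y = mixture_density \<mu> (h' x) q y"
proof -
  have "predictive x y = mixture_density \<mu> (mixture_density \<tau> (posterior x) h) q y"
    unfolding predictive_eq by (rule mixture_density_assoc[OF sigma_finite_\<tau> sigma_finite_\<mu>]) measurable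
  also have "\<dots> = mixture_density \<mu> (h' x) q y"
    unfolding mixture_density_def[of \<mu>]
    by (intro nn_integral_cong) (simp add: h_prime_eq_mixture_over_posterior[OF x G])
  finally show ?thesis .
qed

lemma joint_density_observations:
  assumes joint: "distributed M (\<tau> \<Otimes>\<^sub>M \<nu> \<Otimes>\<^sub>M N) (\<lambda>\<omega>. (T \<omega>, X \<omega>, Y \<omega>))
    (\<lambda>(\<theta>, x, y). prior \<theta> * mixture_density \<mu> (g \<theta>) f x * mixture_density \<mu> (h \<theta>) q y)"
  shows "distributed M (\<nu> \<Otimes>\<^sub>M N) (\<lambda>\<omega>. (X \<omega>, Y \<omega>))
    (\<lambda>(x, y). \<integral>\<^sup>+ \<theta>. prior \<theta> * mixture_density \<mu> (g \<theta>) f x * mixture_density \<mu> (h \<theta>) q y \<partial>\<tau>)"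
    (is "distributed _ _ _ (\<lambda>(x, y). ?j x y)")
proof -
  interpret \<nu>N: pair_sigma_finite \<nu> N ..
  interpret \<tau>\<nu>N: pair_sigma_finite \<tau> "\<nu> \<Otimes>\<^sub>M N" ..
  let ?d = "\<lambda>(\<theta>, x, y). prior \<theta> * mixture_density \<mu> (g \<theta>) f x * mixture_density \<mu> (h \<theta>) q y"
  have "distributed M (\<nu> \<Otimes>\<^sub>M N) (\<lambda>\<omega>. snd (T \<omega>, X \<omega>, Y \<omega>)) (\<lambda>(x, y). ?j x y)"
  proof (rule distributed_map[OF joint])
    fix A assume [measurable]: "A \<in> sets (\<nu> \<Otimes>\<^sub>M N)"
    have "(\<integral>\<^sup>+ v. ?d v * indicator A (snd v) \<partial>(\<tau> \<Otimes>\<^sub>M \<nu> \<Otimes>\<^sub>M N)) =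
        (\<integral>\<^sup>+ w. \<integral>\<^sup>+ \<theta>. ?d (\<theta>, w) * indicator A w \<partial>\<tau> \<partial>(\<nu> \<Otimes>\<^sub>M N))"
      by (subst \<tau>\<nu>N.nn_integral_snd[symmetric]) simp_all
    also have "\<dots> = (\<integral>\<^sup>+ w. (case w of (x, y) \<Rightarrow> ?j x y) * indicator A w \<partial>(\<nu> \<Otimes>\<^sub>M N))"
      by (intro nn_integral_cong) (auto simp: nn_integral_multc space_pair_measure)
    finally show "(\<integral>\<^sup>+ v. ?d v * indicator A (snd v) \<partial>(\<tau> \<Otimes>\<^sub>M \<nu> \<Otimes>\<^sub>M N)) =
        (\<integral>\<^sup>+ w. (case w of (x, y) \<Rightarrow> ?j x y) * indicator A w \<partial>(\<nu> \<Otimes>\<^sub>M N))" .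
  qed measurable
  then show ?thesis by simp
qed

text \<open>
  Conditional independence lets the joint density of \<open>(X, Y)\<close> inherit the factor \<open>C x\<close> from Bayes' rule
  inside the \<open>\<theta>\<close>-integral.
\<close>
lemma predictive_conditional_density:
  assumes joint: "distributed M (\<tau> \<Otimes>\<^sub>M \<nu> \<Otimes>\<^sub>M N) (\<lambda>\<omega>. (T \<omega>, X \<omega>, Y \<omega>))
      (\<lambda>(\<theta>, x, y). prior \<theta> * mixture_density \<mu> (g \<theta>) f x * mixture_density \<mu> (h \<theta>) q y)"
    and G: "G \<subseteq> space \<nu>"
  shows "conditional_density_on G M \<nu> X N Y predictive"
proof (rule conditional_density_onI[OF sigma_finite_N joint_density_observations[OF joint]
      predictive_measurable])
  fix x y assume "x \<in> G" and y [measurable]: "y \<in> space N"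
  with G have x [measurable]: "x \<in> space \<nu>" by auto
  have "(\<integral>\<^sup>+ \<theta>. prior \<theta> * mixture_density \<mu> (g \<theta>) f x * mixture_density \<mu> (h \<theta>) q y \<partial>\<tau>) =
      (\<integral>\<^sup>+ \<theta>. C x * (mixture_density \<mu> (h \<theta>) q y * posterior x \<theta>) \<partial>\<tau>)"
    using x \<open>x \<in> G\<close> by (simp add: prior_times_likelihood ac_simps)
  also have "\<dots> = C x * predictive x y"
    by (simp add: nn_integral_cmult predictive_density_def)
  finally show "(\<integral>\<^sup>+ \<theta>. prior \<theta> * mixture_density \<mu> (g \<theta>) f x * mixture_density \<mu> (h \<theta>) q y \<partial>\<tau>) =
      C x * predictive x y" .
qed (use G in \<open>auto intro: prob_density_predictive\<close>)

end

section \<open>Mixture representations of posterior and predictive density\<close>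

theorem theorem3p1:
  fixes M :: "'w measure"
    and \<mu> :: "'k measure"
    and \<nu> :: "(real ^ 'd) measure"
    and \<Theta> :: "(real ^ 'p) set"
    and \<tau> :: "(real ^ 'p) measure"
    and prior :: "real ^ 'p \<Rightarrow> ennreal"
    and g h :: "real ^ 'p \<Rightarrow> 'k \<Rightarrow> ennreal"
    and f q :: "'k \<Rightarrow> real ^ 'd \<Rightarrow> ennreal"
    and \<rho> :: "'k \<Rightarrow> real ^ 'p \<Rightarrow> ennreal"
    and T :: "'w \<Rightarrow> real ^ 'p"
    and K J :: "'w \<Rightarrow> 'k"
    and X Y :: "'w \<Rightarrow> real ^ 'd"
  assumes "sigma_finite_measure \<mu>"
    and "sigma_finite_measure \<nu>" and "sets \<nu> = sets borel"
    and "sigma_finite_measure \<tau>" and "sets \<tau> = sets (restrict_space borel \<Theta>)"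
    and "prior \<in> borel_measurable \<tau>"
    and "(\<lambda>(\<theta>, k). g \<theta> k) \<in> borel_measurable (\<tau> \<Otimes>\<^sub>M \<mu>)" and "\<And>\<theta>. \<theta> \<in> \<Theta> \<Longrightarrow> prob_density \<mu> (g \<theta>)"
    and "(\<lambda>(\<theta>, j). h \<theta> j) \<in> borel_measurable (\<tau> \<Otimes>\<^sub>M \<mu>)" and "\<And>\<theta>. \<theta> \<in> \<Theta> \<Longrightarrow> prob_density \<mu> (h \<theta>)"
    and "(\<lambda>(k, x). f k x) \<in> borel_measurable (\<mu> \<Otimes>\<^sub>M \<nu>)" and "\<And>k. k \<in> space \<mu> \<Longrightarrow> prob_density \<nu> (f k)"
    and "(\<lambda>(j, y). q j y) \<in> borel_measurable (\<mu> \<Otimes>\<^sub>M \<nu>)" and "\<And>j. j \<in> space \<mu> \<Longrightarrow> prob_density \<nu> (q j)"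
    and "(\<lambda>(k, \<theta>). \<rho> k \<theta>) \<in> borel_measurable (\<mu> \<Otimes>\<^sub>M \<tau>)" and "\<And>k. k \<in> space \<mu> \<Longrightarrow> prob_density \<tau> (\<rho> k)"
    \<comment> \<open>\<open>\<theta>\<close> has prior density; \<open>K | \<theta> \<sim> g\<^sub>\<theta>\<close> and \<open>X | K \<sim> f\<^sub>K\<close>; \<open>J | \<theta> \<sim> h\<^sub>\<theta>\<close> and \<open>Y | J \<sim> q\<^sub>J\<close>\<close>
    and "distributed M (\<tau> \<Otimes>\<^sub>M \<mu> \<Otimes>\<^sub>M \<nu>) (\<lambda>\<omega>. (T \<omega>, K \<omega>, X \<omega>)) (\<lambda>(\<theta>, k, x). prior \<theta> * g \<theta> k * f k x)"
    and "distributed M (\<tau> \<Otimes>\<^sub>M \<mu> \<Otimes>\<^sub>M \<nu>) (\<lambda>\<omega>. (T \<omega>, J \<omega>, Y \<omega>)) (\<lambda>(\<theta>, j, y). prior \<theta> * h \<theta> j * q j y)"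
    \<comment> \<open>\<open>X\<close> and \<open>Y\<close> are independent given \<open>\<theta>\<close>\<close>
    and "distributed M (\<tau> \<Otimes>\<^sub>M \<nu> \<Otimes>\<^sub>M \<nu>) (\<lambda>\<omega>. (T \<omega>, X \<omega>, Y \<omega>))
           (\<lambda>(\<theta>, x, y). prior \<theta> * mixture_density \<mu> (g \<theta>) f x * mixture_density \<mu> (h \<theta>) q y)"
  shows
    \<comment> \<open>the posterior and predictive densities are conditional densities given \<open>X\<close> in the model\<close>
    "conditional_density_on (regular_points \<mu> \<tau> prior g f) M \<nu> X \<tau> T
       (posterior_density \<mu> \<tau> prior g f) \<and>
     conditional_density_on (regular_points \<mu> \<tau> prior g f) M \<nu> X \<nu> Y
       (predictive_density \<mu> \<tau> prior g h f q) \<and>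
     (\<forall>x \<in> regular_points \<mu> \<tau> prior g f.
       \<comment> \<open>(a)\<close>
       (\<exists>(\<Omega> :: ('k \<times> (real ^ 'p)) measure) K' U.
          mixture_representation \<Omega> \<mu> K' (f_prime \<mu> \<tau> prior g f x) \<tau> U (pi_comp \<tau> prior g \<rho>) \<and>
          distributed \<Omega> \<tau> U (posterior_density \<mu> \<tau> prior g f x)) \<and>
       (AE \<theta> in \<tau>. posterior_density \<mu> \<tau> prior g f x \<theta> =
          (\<integral>\<^sup>+ k'. pi_comp \<tau> prior g \<rho> k' \<theta> * f_prime \<mu> \<tau> prior g f x k' \<partial>\<mu>)) \<and>
       \<comment> \<open>(b)\<close>
       (\<exists>(\<Omega> :: ('k \<times> (real ^ 'd)) measure) J' Y'.
          mixture_representation \<Omega> \<mu> J' (h_prime \<mu> \<tau> prior g h \<rho> f x) \<nu> Y' q \<and>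
          distributed \<Omega> \<nu> Y' (predictive_density \<mu> \<tau> prior g h f q x)) \<and>
       (\<forall>y. predictive_density \<mu> \<tau> prior g h f q x y =
          (\<integral>\<^sup>+ j'. q j' y * h_prime \<mu> \<tau> prior g h \<rho> f x j' \<partial>\<mu>)))"
proof -
  have space_\<nu>: "space \<nu> = UNIV"
    using sets_eq_imp_space_eq[OF assms(3)] by simp
  have space_\<tau>: "space \<tau> = \<Theta>"
    using sets_eq_imp_space_eq[OF assms(5)] by (simp add: space_restrict_space)
  interpret mixture_prior \<mu> \<tau> \<nu> prior g f \<rho>
    by (intro mixture_prior.intro assms)
  interpret predictive_mixture \<mu> \<tau> \<nu> prior g f \<rho> \<nu> h q
    by (intro predictive_mixture.intro predictive_mixture_axioms.intro mixture_prior_axioms assms)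
      (simp_all add: space_\<tau> assms(10))
  have G: "G \<subseteq> space \<nu>"
    by (simp add: space_\<nu>)
  have "conditional_density_on G M \<nu> X \<tau> T posterior"
    by (rule posterior_conditional_density[OF assms(17) G])
  moreover have "conditional_density_on G M \<nu> X \<nu> Y predictive"
    by (rule predictive_conditional_density[OF assms(19) G])
  moreover have "(\<exists>(\<Omega> :: ('k \<times> (real ^ 'p)) measure) K' U.
          mixture_representation \<Omega> \<mu> K' (f' x) \<tau> U component \<and> distributed \<Omega> \<tau> U (posterior x)) \<and>
       (AE \<theta> in \<tau>. posterior x \<theta> = (\<integral>\<^sup>+ k'. component k' \<theta> * f' x k' \<partial>\<mu>)) \<and>
       (\<exists>(\<Omega> :: ('k \<times> (real ^ 'd)) measure) J' Y'.
          mixture_representation \<Omega> \<mu> J' (h' x) \<nu> Y' q \<and> distributed \<Omega> \<nu> Y' (predictive x)) \<and>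
       (\<forall>y. predictive x y = (\<integral>\<^sup>+ j'. q j' y * h' x j' \<partial>\<mu>))"
    if G: "x \<in> G" for x
  proof -
    have x: "x \<in> space \<nu>" by (simp add: space_\<nu>)
    have post: "AE \<theta> in \<tau>. posterior x \<theta> = mixture_density \<mu> (f' x) component \<theta>"
      by (rule posterior_eq_mixture[OF x G])
    have pred: "predictive x = mixture_density \<mu> (h' x) q"
      using predictive_eq_mixture[OF x G] by (auto simp: space_\<nu>)
    \<comment> \<open>The canonical model gives \<open>U\<close> the mixture as density; the posterior is a version of it.\<close>
    have "distributed \<Omega> \<tau> U (posterior x)"
      if "distributed \<Omega> \<tau> U (mixture_density \<mu> (f' x) component)"
      for \<Omega> :: "('k \<times> (real ^ 'p)) measure" and U
      using that x distributed_borel_measurable[OF that]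
      by (subst distributed_cong_density[OF post]) simp_all
    then have "\<exists>(\<Omega> :: ('k \<times> (real ^ 'p)) measure) K' U.
        mixture_representation \<Omega> \<mu> K' (f' x) \<tau> U component \<and> distributed \<Omega> \<tau> U (posterior x)"
      using mixture_representation_exists[OF sigma_finite_\<mu> sigma_finite_\<tau> component_measurable
          prob_density_component prob_density_f_prime[OF x G]] by blast
    moreover have "\<exists>(\<Omega> :: ('k \<times> (real ^ 'd)) measure) J' Y'.
        mixture_representation \<Omega> \<mu> J' (h' x) \<nu> Y' q \<and> distributed \<Omega> \<nu> Y' (predictive x)"
      unfolding pred
      by (rule mixture_representation_exists[OF sigma_finite_\<mu> sigma_finite_N q_measurable
          q_density prob_density_h_prime[OF x G]])
    ultimately show ?thesis
      using post by (simp add: pred mixture_density_def)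
  qed
  ultimately show ?thesis by blast
qed

end
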